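(* Let $\omega^u:\mathcal{G}\to\mathbb{N}_0$ be an MCP upper-bound function and let $k,d\in\mathbb{N}_0$ with $0\le d\le k$. If $\omega^u$ is increasing, then a $(k,d,\omega^u)$-truss of a graph is unique; that is, for every $G\in\mathcal{G}$, any two $(k,d,\omega^u)$-trusses of $G$ are equal.
   Context: $\mathcal{G}$ is the class of all finite, simple, undirected graphs, and $\mathbb{N}_0=\{0,1,2,\dots\}$. $N_G(v)$ is the neighborhood of $v$, $G[S]$ the induced subgraph, $H\subseteq G$ means that $H$ is a (not necessarily induced) subgraph of $G$, $\overline{uv}$ denotes the edge joining $u$ and $v$, and $\omega(G)$ is the clique number. $\omega^u:\mathcal{G}\to\mathbb{N}_0$ is an MCP upper-bound function if $\omega(G)\le\omega^u(G)\le|V(G)|$ for every $G\in\mathcal{G}$; it is increasing if $G\subseteq G'$ implies $\omega^u(G)\le\omega^u(G')$. For a clique $K$ of $G$ put $W_G(K):=\bigcap_{x\in K}N_G(x)$. For an edge $\overline{uv}\in E(G)$ and $0\le d\le k$, the condition $C_{G,k,d,\omega^u}(u,v)$ holds if there exists a $(d+2)$-clique $K=\{u,v,w_1,\dots,w_d\}$ of $G$ such that $\omega^u(G[W_G(K)])\ge k-d$. A $(k,d,\omega^u)$-truss of $G=(V,E)$ is a largest (maximum number of edges) spanning subgraph $G'=(V,E')$, $E'\subseteq E$, such that $C_{G',k,d,\omega^u}(u,v)$ holds for every edge $\overline{uv}\in E'$. *)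

theory Defs
  imports Main
begin

record 'a ugraph =
  verts :: "'a set"
  edges :: "'a set set"

definition simple_graph :: "'a ugraph \<Rightarrow> bool" where
  "simple_graph G \<longleftrightarrow> finite (verts G) \<and> (\<forall>e\<in>edges G. e \<subseteq> verts G \<and> card e = 2)"

definition neighborhood :: "'a ugraph \<Rightarrow> 'a \<Rightarrow> 'a set" where
  "neighborhood G v = {w \<in> verts G. {v, w} \<in> edges G}"

definition subgraph :: "'a ugraph \<Rightarrow> 'a ugraph \<Rightarrow> bool" where
  "subgraph H G \<longleftrightarrow> verts H \<subseteq> verts G \<and> edges H \<subseteq> edges G"

definition induced_subgraph :: "'a ugraph \<Rightarrow> 'a set \<Rightarrow> 'a ugraph" where
  "induced_subgraph G S = \<lparr>verts = verts G \<inter> S, edges = {e \<in> edges G. e \<subseteq> S}\<rparr>"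

definition clique :: "'a ugraph \<Rightarrow> 'a set \<Rightarrow> bool" where
  "clique G K \<longleftrightarrow> K \<subseteq> verts G \<and> (\<forall>u\<in>K. \<forall>v\<in>K. u \<noteq> v \<longrightarrow> {u, v} \<in> edges G)"

(* The empty set counts as a clique, so the graph without vertices has clique number 0. *)
definition clique_number :: "'a ugraph \<Rightarrow> nat" where
  "clique_number G = Max (card ` {K. clique G K})"

(* A function on the class of finite simple graphs is a total HOL function;
   its values outside simple_graph are unconstrained. *)
definition mcp_upper_bound :: "('a ugraph \<Rightarrow> nat) \<Rightarrow> bool" where
  "mcp_upper_bound \<omega>u \<longleftrightarrow>
     (\<forall>G. simple_graph G \<longrightarrow> clique_number G \<le> \<omega>u G \<and> \<omega>u G \<le> card (verts G))"

definition increasing :: "('a ugraph \<Rightarrow> nat) \<Rightarrow> bool" where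
  "increasing \<omega>u \<longleftrightarrow>
     (\<forall>G G'. simple_graph G \<longrightarrow> simple_graph G' \<longrightarrow> subgraph G G' \<longrightarrow> \<omega>u G \<le> \<omega>u G')"

(* Used for nonempty K only; for K = {} the intersection is UNIV. *)
definition common_neighborhood :: "'a ugraph \<Rightarrow> 'a set \<Rightarrow> 'a set" where
  "common_neighborhood G K = (\<Inter>x\<in>K. neighborhood G x)"

(* Meant for edges {u, v} of G and d \<le> k, so the subtraction does not truncate. *)
definition truss_condition ::
  "'a ugraph \<Rightarrow> nat \<Rightarrow> nat \<Rightarrow> ('a ugraph \<Rightarrow> nat) \<Rightarrow> 'a \<Rightarrow> 'a \<Rightarrow> bool" where
  "truss_condition G k d \<omega>u u v \<longleftrightarrow>
     (\<exists>K. clique G K \<and> card K = d + 2 \<and> {u, v} \<subseteq> K \<and>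
          k - d \<le> \<omega>u (induced_subgraph G (common_neighborhood G K)))"

definition spanning_subgraph :: "'a ugraph \<Rightarrow> 'a ugraph \<Rightarrow> bool" where
  "spanning_subgraph H G \<longleftrightarrow> subgraph H G \<and> verts H = verts G"

definition truss_feasible ::
  "nat \<Rightarrow> nat \<Rightarrow> ('a ugraph \<Rightarrow> nat) \<Rightarrow> 'a ugraph \<Rightarrow> 'a ugraph \<Rightarrow> bool" where
  "truss_feasible k d \<omega>u G H \<longleftrightarrow> spanning_subgraph H G \<and>
     (\<forall>u v. {u, v} \<in> edges H \<longrightarrow> truss_condition H k d \<omega>u u v)"

definition is_truss ::
  "nat \<Rightarrow> nat \<Rightarrow> ('a ugraph \<Rightarrow> nat) \<Rightarrow> 'a ugraph \<Rightarrow> 'a ugraph \<Rightarrow> bool" where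
  "is_truss k d \<omega>u G H \<longleftrightarrow> truss_feasible k d \<omega>u G H \<and>
     (\<forall>H'. truss_feasible k d \<omega>u G H' \<longrightarrow> card (edges H') \<le> card (edges H))"

end

theory Submission
  imports Defs
begin

text \<open>
  The defining condition of a truss asks only for the existence of edges: for a clique on a given
  edge, and for a large value of the increasing bound on the graph induced by the common
  neighborhood of that clique. Adding edges to the ambient graph keeps the clique, enlarges the
  common neighborhood and so cannot lower the bound (\<open>truss_condition_mono\<close>). Consequently the
  edgewise union of two feasible spanning subgraphs is feasible again (\<open>truss_feasible_union\<close>):
  each edge keeps the witness it had in the subgraph it comes from. Two trusses have the maximum
  number of edges among all feasible subgraphs, so their union has no more edges than either of
  them; as there are finitely many edges, the union equals both.
\<close>

lemma simple_graph_induced_subgraph: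
  "simple_graph G \<Longrightarrow> simple_graph (induced_subgraph G S)"
  by (auto simp: simple_graph_def induced_subgraph_def)

lemma finite_edges:
  assumes "simple_graph G"
  shows "finite (edges G)"
proof (rule finite_subset)
  show "edges G \<subseteq> Pow (verts G)"
    using assms by (auto simp: simple_graph_def)
  show "finite (Pow (verts G))"
    using assms by (simp add: simple_graph_def)
qed

lemma simple_graph_spanning_subgraph:
  assumes "simple_graph G" "spanning_subgraph H G"
  shows "simple_graph H"
  using assms by (auto simp: simple_graph_def spanning_subgraph_def subgraph_def)

lemma clique_mono: "subgraph H H' \<Longrightarrow> clique H K \<Longrightarrow> clique H' K"
  by (auto simp: subgraph_def clique_def)

lemma common_neighborhood_mono:
  "subgraph H H' \<Longrightarrow> common_neighborhood H K \<subseteq> common_neighborhood H' K"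
  by (fastforce simp: subgraph_def common_neighborhood_def neighborhood_def)

lemma induced_subgraph_mono:
  "subgraph H H' \<Longrightarrow> S \<subseteq> S' \<Longrightarrow> subgraph (induced_subgraph H S) (induced_subgraph H' S')"
  by (auto simp: subgraph_def induced_subgraph_def)

text \<open>
  The clique that witnesses the condition in the smaller graph is also a witness in the larger one:
  both its common neighborhood and the edges induced there can only grow. This is the one place
  where monotonicity of the bound enters.
\<close>

lemma truss_condition_mono:
  assumes "increasing \<omega>u" "simple_graph H" "simple_graph H'" "subgraph H H'"
    and "truss_condition H k d \<omega>u u v"
  shows "truss_condition H' k d \<omega>u u v"
proof -
  obtain K where K: "clique H K" "card K = d + 2" "{u, v} \<subseteq> K"
    and bound: "k - d \<le> \<omega>u (induced_subgraph H (common_neighborhood H K))"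
    using assms(5) by (auto simp: truss_condition_def)
  note bound
  also have "\<omega>u (induced_subgraph H (common_neighborhood H K))
      \<le> \<omega>u (induced_subgraph H' (common_neighborhood H' K))"
    using assms(1) simple_graph_induced_subgraph[OF assms(2)]
      simple_graph_induced_subgraph[OF assms(3)]
      induced_subgraph_mono[OF assms(4) common_neighborhood_mono[OF assms(4)]]
    unfolding increasing_def by blast
  finally show ?thesis
    using K clique_mono[OF assms(4)] unfolding truss_condition_def by blast
qed

lemma truss_feasible_union:
  assumes "increasing \<omega>u" "simple_graph G"
    and "truss_feasible k d \<omega>u G H" "truss_feasible k d \<omega>u G H'"
  shows "truss_feasible k d \<omega>u G \<lparr>verts = verts G, edges = edges H \<union> edges H'\<rparr>"
    (is "truss_feasible k d \<omega>u G ?U")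
proof -
  have U: "spanning_subgraph ?U G"
    using assms(3,4) by (auto simp: truss_feasible_def spanning_subgraph_def subgraph_def)
  have "truss_condition ?U k d \<omega>u u v"
    if "truss_feasible k d \<omega>u G F" "edges F \<subseteq> edges ?U" "{u, v} \<in> edges F" for F u v
  proof (rule truss_condition_mono[OF assms(1)])
    show "simple_graph F"
      using simple_graph_spanning_subgraph[OF assms(2)] that(1) by (simp add: truss_feasible_def)
    show "simple_graph ?U"
      using simple_graph_spanning_subgraph[OF assms(2) U] .
    show "subgraph F ?U"
      using that(1,2) by (simp add: truss_feasible_def spanning_subgraph_def subgraph_def)
    show "truss_condition F k d \<omega>u u v"
      using that(1,3) by (simp add: truss_feasible_def)
  qed
  from this[OF assms(3)] this[OF assms(4)] U show ?thesis
    by (auto simp: truss_feasible_def)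
qed

text \<open>
  A truss is thus not merely a largest feasible subgraph by number of edges but the greatest one
  by inclusion, which is the reason for its uniqueness.
\<close>

lemma truss_contains_feasible:
  assumes "increasing \<omega>u" "simple_graph G"
    and "is_truss k d \<omega>u G T" "truss_feasible k d \<omega>u G H"
  shows "edges H \<subseteq> edges T"
proof -
  let ?U = "\<lparr>verts = verts G, edges = edges T \<union> edges H\<rparr>"
  have T: "truss_feasible k d \<omega>u G T"
    using assms(3) by (simp add: is_truss_def)
  have U: "truss_feasible k d \<omega>u G ?U"
    using truss_feasible_union[OF assms(1,2) T assms(4)] .
  then have "finite (edges ?U)"
    using simple_graph_spanning_subgraph[OF assms(2)] finite_edges
    unfolding truss_feasible_def by blast
  moreover have "card (edges ?U) \<le> card (edges T)"
    using assms(3) U unfolding is_truss_def by blast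
  ultimately have "edges T = edges ?U"
    by (intro card_seteq) auto
  then show ?thesis
    by auto
qed

theorem proposition18:
  fixes \<omega>u :: "'a ugraph \<Rightarrow> nat" and k d :: nat and G T T' :: "'a ugraph"
  assumes "mcp_upper_bound \<omega>u"
    and "d \<le> k"
    and "increasing \<omega>u"
    and "simple_graph G"
    and "is_truss k d \<omega>u G T"
    and "is_truss k d \<omega>u G T'"
  shows "T = T'"
proof (rule ugraph.equality)
  have feasible: "truss_feasible k d \<omega>u G T" "truss_feasible k d \<omega>u G T'"
    using assms(5,6) by (simp_all add: is_truss_def)
  then show "verts T = verts T'"
    by (simp add: truss_feasible_def spanning_subgraph_def)
  show "edges T = edges T'"
    using truss_contains_feasible[OF assms(3,4,5) feasible(2)]
      truss_contains_feasible[OF assms(3,4,6) feasible(1)] by (rule equalityI[rotated])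
qed simp

end
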